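(* Let $\Bbbk$ be an algebraically closed field of characteristic zero, $q\in\Bbbk^\times$, and $\kappa=(\kappa_1,\kappa_2)\in\mathbb Z^2$. Then the Poisson field $K_{q,\kappa}=K\{q\,x^{1+\kappa_1}y^{1+\kappa_2}\}$ fails to satisfy the Dixmier property.
   Context: For $\mathbf f\in\Bbbk(x,y)$, $K\{\mathbf f\}$ denotes the rational function field $\Bbbk(x,y)$ equipped with the unique ($\Bbbk$-bilinear) Poisson bracket such that $\{x,y\}=\mathbf f$; explicitly $\{g,h\}=\left(\frac{\partial g}{\partial x}\frac{\partial h}{\partial y}-\frac{\partial g}{\partial y}\frac{\partial h}{\partial x}\right)\mathbf f$. A Poisson field $K$ has the Dixmier property if every Poisson endomorphism of $K$ (a $\Bbbk$-algebra endomorphism preserving the Poisson bracket) is an automorphism. *)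

theory Defs
  imports "HOL-Computational_Algebra.Computational_Algebra"
begin

section \<open>Poisson fields and the Dixmier property\<close>

text \<open>
  A Poisson field over a ground field is a field \<open>'f\<close>, made into an algebra by a homomorphism
  \<open>\<iota>\<close> from the ground field \<open>'k\<close>, together with a Poisson bracket \<open>B\<close>.
\<close>

definition poisson_field :: "('k::field \<Rightarrow> 'f::field) \<Rightarrow> ('f \<Rightarrow> 'f \<Rightarrow> 'f) \<Rightarrow> bool" where
  "poisson_field \<iota> B \<longleftrightarrow>
     \<iota> 1 = 1 \<and> (\<forall>a b. \<iota> (a + b) = \<iota> a + \<iota> b) \<and> (\<forall>a b. \<iota> (a * b) = \<iota> a * \<iota> b) \<and>
     (\<forall>g h u. B (g + h) u = B g u + B h u) \<and> (\<forall>c g u. B (\<iota> c * g) u = \<iota> c * B g u) \<and>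
     (\<forall>u g h. B u (g + h) = B u g + B u h) \<and> (\<forall>c u g. B u (\<iota> c * g) = \<iota> c * B u g) \<and>
     (\<forall>g. B g g = 0) \<and>
     (\<forall>g h u. B (g * h) u = g * B h u + h * B g u) \<and>
     (\<forall>g h u. B g (B h u) + B h (B u g) + B u (B g h) = 0)"

definition poisson_endomorphism ::
    "('k::field \<Rightarrow> 'f::field) \<Rightarrow> ('f \<Rightarrow> 'f \<Rightarrow> 'f) \<Rightarrow> ('f \<Rightarrow> 'f) \<Rightarrow> bool" where
  "poisson_endomorphism \<iota> B \<sigma> \<longleftrightarrow>
     \<sigma> 1 = 1 \<and> (\<forall>g h. \<sigma> (g + h) = \<sigma> g + \<sigma> h) \<and> (\<forall>g h. \<sigma> (g * h) = \<sigma> g * \<sigma> h) \<and>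
     (\<forall>c. \<sigma> (\<iota> c) = \<iota> c) \<and>
     (\<forall>g h. \<sigma> (B g h) = B (\<sigma> g) (\<sigma> h))"

definition poisson_automorphism ::
    "('k::field \<Rightarrow> 'f::field) \<Rightarrow> ('f \<Rightarrow> 'f \<Rightarrow> 'f) \<Rightarrow> ('f \<Rightarrow> 'f) \<Rightarrow> bool" where
  "poisson_automorphism \<iota> B \<sigma> \<longleftrightarrow> poisson_endomorphism \<iota> B \<sigma> \<and> bij \<sigma>"

definition dixmier_property :: "('k::field \<Rightarrow> 'f::field) \<Rightarrow> ('f \<Rightarrow> 'f \<Rightarrow> 'f) \<Rightarrow> bool" where
  "dixmier_property \<iota> B \<longleftrightarrow>
     (\<forall>\<sigma>. poisson_endomorphism \<iota> B \<sigma> \<longrightarrow> poisson_automorphism \<iota> B \<sigma>)"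


section \<open>The rational function field in two variables\<close>

text \<open>
  The field \<open>k(x,y)\<close> is the fraction field of \<open>k[x][y]\<close>: in \<open>'k poly poly\<close>
  the inner variable is \<open>x\<close> and the outer one is \<open>y\<close>.
\<close>

type_synonym 'k ratfun2 = "'k poly poly fract"

definition rf_const :: "'k::field \<Rightarrow> 'k ratfun2" where
  "rf_const c = to_fract [:[:c:]:]"

definition rf_X :: "'k::field ratfun2" where
  "rf_X = to_fract [:[:0, 1:]:]"

definition rf_Y :: "'k::field ratfun2" where
  "rf_Y = to_fract [:0, 1:]"

abbreviation poly_ddx :: "'k::field poly poly \<Rightarrow> 'k poly poly" where
  "poly_ddx \<equiv> map_poly pderiv"

lemma poly_ddx_add: "poly_ddx (p + q) = poly_ddx p + poly_ddx q"
  by (rule poly_eqI) (simp add: coeff_map_poly pderiv_add)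

lemma poly_ddx_smult: "poly_ddx (smult a p) = smult (pderiv a) p + smult a (poly_ddx p)"
  by (rule poly_eqI) (simp add: coeff_map_poly pderiv_mult)

lemma poly_ddx_pCons: "poly_ddx (pCons a p) = pCons (pderiv a) (poly_ddx p)"
  by (rule poly_eqI) (auto simp: coeff_map_poly coeff_pCons split: nat.splits)

lemma poly_ddx_1: "poly_ddx 1 = 0"
  by (simp add: one_pCons poly_ddx_pCons pderiv_pCons)

lemma poly_ddx_mult: "poly_ddx (p * q) = p * poly_ddx q + q * poly_ddx p"
  by (induction p)
     (simp_all add: poly_ddx_add poly_ddx_smult poly_ddx_pCons algebra_simps)

lemma poly_ddx_pderiv: "poly_ddx (pderiv p) = pderiv (poly_ddx p)"
  by (induction p) (simp_all add: pderiv_pCons poly_ddx_add poly_ddx_pCons)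

lemma quotient_rule_respects:
  fixes a b c d a' b' c' d' :: "'a::idom"
  assumes "a * d = c * b" and "a * d' + d * a' = c * b' + b * c'"
  shows "(a' * b - a * b') * (d * d) = (c' * d - c * d') * (b * b)"
  using assms by algebra

text \<open>
  Extension of a derivation to fractions by the quotient rule, computed on a representative;
  \<open>fract_deriv_Fract\<close> shows that the choice of the representative does not matter.
\<close>

definition fract_deriv :: "('a::idom \<Rightarrow> 'a) \<Rightarrow> 'a fract \<Rightarrow> 'a fract" where
  "fract_deriv d g = (case rep_fract g of (a, b) \<Rightarrow> Fract (d a * b - a * d b) (b * b))"

lemma fract_deriv_Fract:
  assumes leibniz: "\<And>u v. d (u * v) = u * d v + v * d u" and "b \<noteq> 0"
  shows "fract_deriv d (Fract a b) = Fract (d a * b - a * d b) (b * b)"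
proof -
  obtain a' b' where rep: "rep_fract (Fract a b) = (a', b')" by fastforce
  have "fractrel (a', b') (a', b')" and "abs_fract (a', b') = Fract a b"
    using Quotient_rep_reflp[OF Quotient_fract, of "Fract a b"]
      Quotient_abs_rep[OF Quotient_fract, of "Fract a b"] rep by simp_all
  then have "b' \<noteq> 0" and "Fract a' b' = Fract a b"
    by (simp_all add: Fract.abs_eq)
  then have eq: "a' * b = a * b'" and nz: "b' \<noteq> 0"
    using \<open>b \<noteq> 0\<close> by (simp_all add: eq_fract)
  from eq have "d (a' * b) = d (a * b')" by simp
  then show ?thesis
    using quotient_rule_respects[OF eq, of "d b" "d a'" "d b'" "d a"] nz \<open>b \<noteq> 0\<close>
    by (simp add: fract_deriv_def rep eq_fract leibniz)
qed

definition rf_ddx :: "'k::field ratfun2 \<Rightarrow> 'k ratfun2" where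
  "rf_ddx = fract_deriv poly_ddx"

definition rf_ddy :: "'k::field ratfun2 \<Rightarrow> 'k ratfun2" where
  "rf_ddy = fract_deriv pderiv"

lemma rf_ddx_Fract:
  "b \<noteq> 0 \<Longrightarrow> rf_ddx (Fract a b) = Fract (poly_ddx a * b - a * poly_ddx b) (b * b)"
  unfolding rf_ddx_def by (rule fract_deriv_Fract) (rule poly_ddx_mult)

lemma rf_ddy_Fract:
  "b \<noteq> 0 \<Longrightarrow> rf_ddy (Fract a b) = Fract (pderiv a * b - a * pderiv b) (b * b)"
  unfolding rf_ddy_def by (rule fract_deriv_Fract) (rule pderiv_mult)

text \<open>\<open>rf_bracket f\<close> is the bracket of \<open>K{f}\<close>.\<close>

definition rf_bracket ::
    "'k::field ratfun2 \<Rightarrow> 'k ratfun2 \<Rightarrow> 'k ratfun2 \<Rightarrow> 'k ratfun2" where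
  "rf_bracket f g h = (rf_ddx g * rf_ddy h - rf_ddy g * rf_ddx h) * f"


section \<open>\<open>K{f}\<close> is a Poisson field, and its bracket is determined by \<open>{x,y} = f\<close>\<close>

lemma rf_ddx_add: "rf_ddx (g + h) = rf_ddx g + rf_ddx h"
  by (cases g, cases h)
     (simp add: rf_ddx_Fract eq_fract poly_ddx_add poly_ddx_mult algebra_simps)

lemma rf_ddx_mult: "rf_ddx (g * h) = g * rf_ddx h + h * rf_ddx g"
  by (cases g, cases h)
     (simp add: rf_ddx_Fract eq_fract poly_ddx_add poly_ddx_mult algebra_simps)

lemma rf_ddy_add: "rf_ddy (g + h) = rf_ddy g + rf_ddy h"
  by (cases g, cases h)
     (simp add: rf_ddy_Fract eq_fract pderiv_add pderiv_mult algebra_simps)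

lemma rf_ddy_mult: "rf_ddy (g * h) = g * rf_ddy h + h * rf_ddy g"
  by (cases g, cases h)
     (simp add: rf_ddy_Fract eq_fract pderiv_add pderiv_mult algebra_simps)

lemma rf_to_fract:
  "rf_ddx (to_fract p) = to_fract (poly_ddx p)" "rf_ddy (to_fract p) = to_fract (pderiv p)"
  by (simp_all add: to_fract_def rf_ddx_Fract rf_ddy_Fract poly_ddx_1)

lemma rf_deriv_0_1: "rf_ddx 0 = 0" "rf_ddx 1 = 0" "rf_ddy 0 = 0" "rf_ddy 1 = 0"
  using rf_to_fract[of 0] rf_to_fract[of 1] by (simp_all add: poly_ddx_1)

lemma rf_deriv_gens:
  "rf_ddx (rf_const c) = 0" "rf_ddx rf_X = 1" "rf_ddx rf_Y = 0"
  "rf_ddy (rf_const c) = 0" "rf_ddy rf_X = 0" "rf_ddy rf_Y = 1"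
  by (simp_all add: rf_const_def rf_X_def rf_Y_def rf_to_fract poly_ddx_pCons pderiv_pCons
        poly_ddx_1 flip: one_pCons)

lemma rf_ddx_uminus: "rf_ddx (- g) = - rf_ddx g"
  using rf_ddx_add[of "- g" g] by (simp add: rf_deriv_0_1 eq_neg_iff_add_eq_0)

lemma rf_ddy_uminus: "rf_ddy (- g) = - rf_ddy g"
  using rf_ddy_add[of "- g" g] by (simp add: rf_deriv_0_1 eq_neg_iff_add_eq_0)

lemma rf_ddx_diff: "rf_ddx (g - h) = rf_ddx g - rf_ddx h"
  using rf_ddx_add[of g "- h"] by (simp add: rf_ddx_uminus)

lemma rf_ddy_diff: "rf_ddy (g - h) = rf_ddy g - rf_ddy h"
  using rf_ddy_add[of g "- h"] by (simp add: rf_ddy_uminus)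

lemma derivation_determined:
  fixes D :: "'k::field ratfun2 \<Rightarrow> 'k ratfun2"
  assumes add: "\<And>g h. D (g + h) = D g + D h"
    and mult: "\<And>g h. D (g * h) = g * D h + h * D g"
    and const: "\<And>c. D (rf_const c) = 0"
  shows "D g = rf_ddx g * D rf_X + rf_ddy g * D rf_Y"
proof -
  define E where "E g = rf_ddx g * D rf_X + rf_ddy g * D rf_Y" for g
  have E_add: "E (g + h) = E g + E h" for g h
    by (simp add: E_def rf_ddx_add rf_ddy_add algebra_simps)
  have E_mult: "E (g * h) = g * E h + h * E g" for g h
    by (simp add: E_def rf_ddx_mult rf_ddy_mult algebra_simps)
  have E_const: "E (rf_const c) = 0" and E_X: "E rf_X = D rf_X" and E_Y: "E rf_Y = D rf_Y" for c
    by (simp_all add: E_def rf_deriv_gens)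
  have inner: "D (to_fract [:p:]) = E (to_fract [:p:])" for p
  proof (induction p)
    case 0
    show ?case using const[of 0] E_const[of 0] by (simp add: rf_const_def)
  next
    case (pCons a p)
    have "to_fract [:pCons a p:] = rf_const a + rf_X * to_fract [:p:]"
      by (simp add: rf_const_def rf_X_def flip: to_fract_add to_fract_mult)
    with pCons show ?case by (simp add: add mult const E_add E_mult E_const E_X)
  qed
  have outer: "D (to_fract p) = E (to_fract p)" for p
  proof (induction p)
    case 0
    show ?case using inner[of 0] by simp
  next
    case (pCons a p)
    have "to_fract (pCons a p) = to_fract [:a:] + rf_Y * to_fract p"
      by (simp add: rf_Y_def flip: to_fract_add to_fract_mult)
    with pCons show ?case by (simp add: add mult inner E_add E_mult E_Y)
  qed
  obtain a b where g: "g = Fract a b" and b: "b \<noteq> 0" by (cases g)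
  have gb: "g * to_fract b = to_fract a" and nz: "to_fract b \<noteq> 0"
    using b by (simp_all add: g to_fract_def eq_fract Zero_fract_def)
  have "D (g * to_fract b) = E (g * to_fract b)" by (simp add: gb outer)
  with nz have "D g = E g" by (simp add: mult E_mult outer)
  then show ?thesis by (simp add: E_def)
qed

lemma rf_ddx_ddy: "rf_ddx (rf_ddy g) = rf_ddy (rf_ddx g)"
proof -
  have "rf_ddx (rf_ddy g) - rf_ddy (rf_ddx g) = 0"
    by (subst derivation_determined[where D = "\<lambda>g. rf_ddx (rf_ddy g) - rf_ddy (rf_ddx g)"])
       (simp_all add: rf_ddx_add rf_ddy_add rf_ddx_mult rf_ddy_mult rf_deriv_gens
          rf_deriv_0_1 algebra_simps)
  then show ?thesis by simp
qed

lemma rf_const_hom: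
  "rf_const 1 = 1" "rf_const (a + b) = rf_const a + rf_const b"
  "rf_const (a * b) = rf_const a * rf_const b"
  by (simp_all add: rf_const_def flip: to_fract_add to_fract_mult one_pCons)

theorem poisson_field_rf_bracket: "poisson_field rf_const (rf_bracket f)"
proof -
  have "rf_bracket f g (rf_bracket f h u) + rf_bracket f h (rf_bracket f u g)
          + rf_bracket f u (rf_bracket f g h) = 0" for g h u
    unfolding rf_bracket_def rf_ddx_mult rf_ddy_mult rf_ddx_diff rf_ddy_diff rf_ddx_ddy
    by algebra
  then show ?thesis
    unfolding poisson_field_def
    by (auto simp: rf_const_hom rf_bracket_def rf_ddx_add rf_ddy_add rf_ddx_mult rf_ddy_mult
          rf_deriv_gens algebra_simps)
qed

theorem rf_bracket_unique:
  assumes "poisson_field rf_const B" and "B rf_X rf_Y = f"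
  shows "B = rf_bracket f"
proof (intro ext)
  fix g h
  note B = assms(1)[unfolded poisson_field_def]
  have anti: "B u v = - B v u" for u v
  proof -
    have "B (u + v) (u + v) = B u u + B u v + (B v u + B v v)" using B by metis
    with B show ?thesis by (simp add: eq_neg_iff_add_eq_0)
  qed
  have B1: "B 1 u = 0" for u
  proof -
    have "B (1 * 1) u = 1 * B 1 u + 1 * B 1 u" using B by metis
    then have "B 1 u = B 1 u + B 1 u" by (simp only: mult_1)
    then show ?thesis by (simp only: add_cancel_right_right)
  qed
  have const: "B (rf_const c) u = 0" for c u
  proof -
    have "B (rf_const c * 1) u = rf_const c * B 1 u" using B by metis
    then show ?thesis by (simp add: B1)
  qed
  have left: "B u v = rf_ddx u * B rf_X v + rf_ddy u * B rf_Y v" for u v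
    by (rule derivation_determined[where D = "\<lambda>u. B u v"]) (use B const in auto)
  have "B rf_X h = rf_ddy h * f" "B rf_Y h = - (rf_ddx h * f)"
    using left[of h rf_X] left[of h rf_Y] anti[of rf_X h] anti[of rf_Y h] anti[of rf_Y rf_X]
      B assms(2) by auto
  then show "B g h = rf_bracket f g h"
    by (simp add: left[of g h] rf_bracket_def algebra_simps)
qed

lemma rf_bracket_X_Y: "rf_bracket f rf_X rf_Y = f"
  by (simp add: rf_bracket_def rf_deriv_gens)

end

theory Submission
  imports Defs
begin

section \<open>Ring homomorphisms and their extensions\<close>

text \<open>A pair \<open>(u,v)\<close> of rational functions with nonzero Jacobian
  \<open>J(u,v)\<close> defines an endomorphism x -> u, y -> v of \<open>k(x,y)\<close>
  (\<open>rf_endomorphism_exists\<close>), and by the chain rule it is Poisson for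
  \<open>K{f}\<close> once J(u,v) f = f(u,v) (\<open>poisson_endomorphismI\<close>). It is not onto
  if some nontrivial endomorphism \<tau> fixes both u and v, since \<tau> then fixes the whole image
  (\<open>not_dixmier_propertyI\<close>). It remains to find u, v and \<tau>.

  If \<kappa> is nonzero, monomials suffice. For an integer vector w orthogonal to \<kappa>, the
  exponent matrix \<open>I + w w^T\<close> fixes \<kappa> and has determinant d > 1, so J(u,v) = d u
  v / (x y). Scalar factors \<alpha>, \<beta> with \<alpha>^\<kappa>1 \<beta>^\<kappa>2 = d, which
  exist over an algebraically closed field, make the map Poisson; \<tau> multiplies x and y by d-th
  roots of unity.

  If \<kappa> = 0, a monomial Poisson map has determinant 1 and is invertible. Instead \<tau> is the
  involution (x,y) -> (1/x,1/y), and x(y^2-1)/(x^2y^2-1), y(x^2-1)/(x^2y^2-1) are invariants with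
  J(u,v) x y = u v.\<close>

locale unital_ring_hom =
  fixes h :: "'a::comm_ring_1 \<Rightarrow> 'b::comm_ring_1"
  assumes one: "h 1 = 1"
    and add: "h (a + b) = h a + h b"
    and mult: "h (a * b) = h a * h b"
begin

lemma zero: "h 0 = 0"
  using add[of 0 0] by simp

lemma uminus: "h (- a) = - h a"
  using add[of "- a" a] by (simp add: zero eq_neg_iff_add_eq_0)

lemma diff: "h (a - b) = h a - h b"
  using add[of a "- b"] by (simp add: uminus)

lemma power: "h (a ^ n) = h a ^ n"
  by (induction n) (simp_all add: one mult)

lemma poly_map_poly_pCons: "poly (map_poly h (pCons a p)) u = h a + u * poly (map_poly h p) u"
  by (simp add: map_poly_pCons zero)

text \<open>Applied twice, to the inner and then to the outer variable, this makes evaluation on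
  \<open>k[x][y]\<close> a homomorphism.\<close>

lemma unital_ring_hom_poly: "unital_ring_hom (\<lambda>p. poly (map_poly h p) u)"
proof
  show "poly (map_poly h 1) u = 1"
    by (simp add: one)
  show hom_add: "poly (map_poly h (p + q)) u = poly (map_poly h p) u + poly (map_poly h q) u" for p q
  proof -
    have "map_poly h (p + q) = map_poly h p + map_poly h q"
      by (rule poly_eqI) (simp add: coeff_map_poly zero add)
    then show ?thesis by simp
  qed
  have hom_smult: "poly (map_poly h (smult c q)) u = h c * poly (map_poly h q) u" for c q
  proof -
    have "map_poly h (smult c q) = smult (h c) (map_poly h q)"
      by (rule poly_eqI) (simp add: coeff_map_poly zero mult)
    then show ?thesis by simp
  qed
  show "poly (map_poly h (p * q)) u = poly (map_poly h p) u * poly (map_poly h q) u" for p q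
  proof (induction p)
    case 0
    show ?case by simp
  next
    case (pCons a p)
    then show ?case
      by (simp add: hom_add hom_smult poly_map_poly_pCons zero algebra_simps)
  qed
qed

end

lemma unital_ring_hom_powi:
  fixes h :: "'a::field \<Rightarrow> 'b::field"
  assumes "unital_ring_hom h"
  shows "h (a powi n) = h a powi n"
proof -
  interpret unital_ring_hom h by fact
  have inv: "h (inverse a) = inverse (h a)" for a
  proof (cases "a = 0")
    case False
    then have "h a * h (inverse a) = 1"
      by (simp add: one flip: mult)
    then show ?thesis
      by (metis inverse_unique)
  qed (simp add: zero)
  show ?thesis
    by (simp add: power_int_def power inv)
qed

text \<open>The value is read off an arbitrary representative; it is independent of the choice when
  \<open>h\<close> is a homomorphism with zero kernel, which also keeps the denominators
  nonzero.\<close>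

definition fract_lift :: "('a::idom \<Rightarrow> 'b::field) \<Rightarrow> 'a fract \<Rightarrow> 'b" where
  "fract_lift h g = (case rep_fract g of (a, b) \<Rightarrow> h a / h b)"

context
  fixes h :: "'a::idom \<Rightarrow> 'b::field"
  assumes hom: "unital_ring_hom h" and nonzero: "\<And>a. h a = 0 \<Longrightarrow> a = 0"
begin

interpretation unital_ring_hom h by (fact hom)

lemma fract_lift_Fract:
  assumes "b \<noteq> 0"
  shows "fract_lift h (Fract a b) = h a / h b"
proof -
  obtain a' b' where rep: "rep_fract (Fract a b) = (a', b')" by fastforce
  have "fractrel (a', b') (a', b')" and "abs_fract (a', b') = Fract a b"
    using Quotient_rep_reflp[OF Quotient_fract, of "Fract a b"]
      Quotient_abs_rep[OF Quotient_fract, of "Fract a b"] rep by simp_all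
  then have nz: "b' \<noteq> 0" and "Fract a' b' = Fract a b"
    by (simp_all add: Fract.abs_eq)
  then have "h (a' * b) = h (a * b')"
    using assms by (simp add: eq_fract)
  moreover have "h b \<noteq> 0" "h b' \<noteq> 0"
    using nz assms nonzero by auto
  ultimately show ?thesis
    by (simp add: fract_lift_def rep mult field_simps)
qed

lemma fract_lift_to_fract: "fract_lift h (to_fract a) = h a"
  by (simp add: to_fract_def fract_lift_Fract one)

lemma unital_ring_hom_fract_lift: "unital_ring_hom (fract_lift h)"
proof
  show "fract_lift h 1 = 1"
    using fract_lift_to_fract[of 1] by (simp add: one)
  have nz: "h b \<noteq> 0" if "b \<noteq> 0" for b
    using that nonzero by auto
  show "fract_lift h (f + g) = fract_lift h f + fract_lift h g" for f g
    by (cases f, cases g) (simp add: fract_lift_Fract nz add mult field_simps)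
  show "fract_lift h (f * g) = fract_lift h f * fract_lift h g" for f g
    by (cases f, cases g) (simp add: fract_lift_Fract nz mult field_simps)
qed

end


section \<open>Endomorphisms of the rational function field\<close>

locale rf_derivation =
  fixes D :: "'k::field ratfun2 \<Rightarrow> 'k ratfun2"
  assumes add: "D (f + g) = D f + D g"
    and mult: "D (f * g) = f * D g + g * D f"
    and const: "D (rf_const c) = 0"
begin

lemma zero: "D 0 = 0"
  using const[of 0] by (simp add: rf_const_def)

lemma one: "D 1 = 0"
  using const[of 1] by (simp add: rf_const_hom)

lemma uminus: "D (- f) = - D f"
  using add[of "- f" f] by (simp add: zero eq_neg_iff_add_eq_0)

lemma diff: "D (f - g) = D f - D g"
  using add[of f "- g"] by (simp add: uminus)

lemma divide:
  assumes "g \<noteq> 0"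
  shows "D (f / g) = (D f * g - f * D g) / g\<^sup>2"
proof -
  have "D f = D (f / g * g)"
    using assms by simp
  also have "\<dots> = f / g * D g + g * D (f / g)"
    by (rule mult)
  finally show ?thesis
    using assms by (simp add: field_simps power2_eq_square)
qed

text \<open>The logarithmic derivative \<open>D f / f\<close> keeps the exponent at
  \<open>n\<close>, so that for monomials only integer factors remain.\<close>

lemma power_int:
  assumes "f \<noteq> 0"
  shows "D (f powi n) = of_int n * f powi n * (D f / f)"
proof -
  have pow: "D (f ^ n) = of_nat n * f ^ n * (D f / f)" for n
    using assms by (induction n) (simp_all add: one mult field_simps)
  show ?thesis
  proof (cases "n \<ge> 0")
    case True
    then show ?thesis
      using pow[of "nat n"] by (simp add: power_int_def)
  next
    case False
    have "D (1 / f ^ nat (- n)) = - of_nat (nat (- n)) * (1 / f ^ nat (- n)) * (D f / f)"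
      using assms by (simp add: divide one pow power2_eq_square)
    with False show ?thesis
      by (simp add: power_int_def divide_inverse power_inverse)
  qed
qed

end

lemma rf_derivation_ddx: "rf_derivation rf_ddx"
  by standard (simp_all add: rf_ddx_add rf_ddx_mult rf_deriv_gens)

lemma rf_derivation_ddy: "rf_derivation rf_ddy"
  by standard (simp_all add: rf_ddy_add rf_ddy_mult rf_deriv_gens)

section \<open>Evaluation of polynomials at a pair of rational functions\<close>

lemma unital_ring_hom_rf_const: "unital_ring_hom rf_const"
  by standard (simp_all add: rf_const_hom)

text \<open>This is \<open>P(u,v)\<close>: the coefficients, polynomials in x, are evaluated at
  \<open>u\<close>, then the outer variable y at \<open>v\<close>.\<close>

definition rf_eval ::
    "'k::field ratfun2 \<Rightarrow> 'k ratfun2 \<Rightarrow> 'k poly poly \<Rightarrow> 'k ratfun2" where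
  "rf_eval u v P = poly (map_poly (\<lambda>p. poly (map_poly rf_const p) u) P) v"

lemma unital_ring_hom_rf_eval: "unital_ring_hom (rf_eval u v)"
  unfolding rf_eval_def
  by (intro unital_ring_hom.unital_ring_hom_poly unital_ring_hom_rf_const)

lemma rf_eval_pCons: "rf_eval u v (pCons p P) = rf_eval u v [:p:] + v * rf_eval u v P"
  unfolding rf_eval_def
  by (simp add: unital_ring_hom.poly_map_poly_pCons
      unital_ring_hom.unital_ring_hom_poly[OF unital_ring_hom_rf_const])

lemma rf_eval_pCons_inner: "rf_eval u v [:pCons a p:] = rf_const a + u * rf_eval u v [:p:]"
  unfolding rf_eval_def
  by (simp add: map_poly_pCons
      unital_ring_hom.poly_map_poly_pCons[OF unital_ring_hom_rf_const])

lemma rf_eval_gens: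
  "rf_eval u v [:[:c:]:] = rf_const c" "rf_eval u v [:[:0, 1:]:] = u" "rf_eval u v [:0, 1:] = v"
proof -
  interpret unital_ring_hom "rf_eval u v"
    by (rule unital_ring_hom_rf_eval)
  have c0: "rf_const 0 = 0"
    by (rule unital_ring_hom.zero[OF unital_ring_hom_rf_const])
  have const: "rf_eval u v [:[:c:]:] = rf_const c" for c
    using rf_eval_pCons_inner[of u v c 0] by (simp add: zero)
  show "rf_eval u v [:[:c:]:] = rf_const c"
    by (rule const)
  show "rf_eval u v [:[:0, 1:]:] = u"
    using rf_eval_pCons_inner[of u v 0 "[:1:]"] by (simp add: const c0 rf_const_hom)
  show "rf_eval u v [:0, 1:] = v"
    using rf_eval_pCons[of u v 0 "[:1:]"] by (simp add: zero one flip: one_pCons)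
qed

text \<open>The product rule propagates the identity through Horner's scheme, in x for the
  coefficients and then in y.\<close>

lemma (in rf_derivation) chain_rule_rf_eval:
  "D (rf_eval u v P) = rf_eval u v (poly_ddx P) * D u + rf_eval u v (pderiv P) * D v"
proof -
  interpret ev: unital_ring_hom "rf_eval u v"
    by (rule unital_ring_hom_rf_eval)
  have inner: "D (rf_eval u v [:p:]) = rf_eval u v [:pderiv p:] * D u" for p
  proof (induction p)
    case 0
    show ?case by (simp add: ev.zero zero)
  next
    case (pCons a p)
    have "rf_eval u v [:pderiv (pCons a p):] = rf_eval u v [:p:] + u * rf_eval u v [:pderiv p:]"
      using ev.add[of "[:p:]" "[:pCons 0 (pderiv p):]"] rf_eval_pCons_inner[of u v 0 "pderiv p"]
      by (simp add: pderiv_pCons unital_ring_hom.zero[OF unital_ring_hom_rf_const])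
    with pCons show ?case
      by (simp add: rf_eval_pCons_inner add mult const algebra_simps)
  qed
  show ?thesis
  proof (induction P)
    case 0
    show ?case by (simp add: ev.zero zero)
  next
    case (pCons p P)
    have "rf_eval u v (pderiv (pCons p P)) = rf_eval u v P + v * rf_eval u v (pderiv P)"
      using rf_eval_pCons[of u v 0 "pderiv P"] by (simp add: pderiv_pCons ev.add ev.zero)
    moreover have "rf_eval u v (poly_ddx (pCons p P))
        = rf_eval u v [:pderiv p:] + v * rf_eval u v (poly_ddx P)"
      by (simp add: poly_ddx_pCons rf_eval_pCons[of u v _ "poly_ddx P"])
    ultimately show ?case
      using pCons by (simp add: rf_eval_pCons[of u v p P] add mult inner algebra_simps)
  qed
qed

section \<open>Algebraic independence from a nonzero Jacobian\<close>

definition rf_jacobian :: "'k::field ratfun2 \<Rightarrow> 'k ratfun2 \<Rightarrow> 'k ratfun2" where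
  "rf_jacobian u v = rf_ddx u * rf_ddy v - rf_ddy u * rf_ddx v"

text \<open>
  A relation \<open>P(u,v) = 0\<close> passes to both partial derivatives of \<open>P\<close>, because the
  Jacobian matrix is invertible; in characteristic zero this descends to a constant.
\<close>

lemma rf_eval_eq_0_imp:
  fixes u v :: "'k::field_char_0 ratfun2"
  assumes J: "rf_jacobian u v \<noteq> 0" and "rf_eval u v P = 0"
  shows "P = 0"
proof -
  interpret ev: unital_ring_hom "rf_eval u v"
    by (rule unital_ring_hom_rf_eval)
  have partials: "rf_eval u v (poly_ddx P) = 0 \<and> rf_eval u v (pderiv P) = 0"
    if "rf_eval u v P = 0" for P
  proof -
    let ?a = "rf_eval u v (poly_ddx P)" and ?b = "rf_eval u v (pderiv P)"
    have "?a * rf_ddx u + ?b * rf_ddx v = 0" "?a * rf_ddy u + ?b * rf_ddy v = 0"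
      using rf_derivation.chain_rule_rf_eval[OF rf_derivation_ddx, of u v P]
        rf_derivation.chain_rule_rf_eval[OF rf_derivation_ddy, of u v P] that
      by (simp_all add: rf_deriv_0_1)
    \<comment> \<open>Cramer's rule: eliminate one unknown from the two linear equations.\<close>
    then have "?a * rf_jacobian u v = 0" "?b * rf_jacobian u v = 0"
      unfolding rf_jacobian_def by algebra+
    with J show ?thesis by simp
  qed
  have inner: "p = 0" if "rf_eval u v [:p:] = 0" for p
    using that
  proof (induction "degree p" arbitrary: p rule: less_induct)
    case less
    have "rf_eval u v [:pderiv p:] = 0"
      using partials[OF less.prems] by (simp add: poly_ddx_pCons)
    \<comment> \<open>For positive degree the derivative has smaller degree, so it vanishes by
      induction, which characteristic zero forbids.\<close>
    then have "degree p = 0"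
      using less.hyps[of "pderiv p"] by (cases "degree p = 0") (auto simp: degree_pderiv pderiv_eq_0_iff)
    then obtain c where p: "p = [:c:]"
      by (rule degree_eq_zeroE)
    with less.prems have "rf_const c = 0"
      by (simp add: rf_eval_gens)
    with p show ?case
      by (simp add: rf_const_def)
  qed
  show ?thesis
    using assms(2)
  proof (induction "degree P" arbitrary: P rule: less_induct)
    case less
    have "rf_eval u v (pderiv P) = 0"
      using partials[OF less.prems] by simp
    then have "degree P = 0"
      using less.hyps[of "pderiv P"] by (cases "degree P = 0") (auto simp: degree_pderiv pderiv_eq_0_iff)
    then obtain p where "P = [:p:]"
      by (rule degree_eq_zeroE)
    with less.prems inner show ?case by simp
  qed
qed

section \<open>Endomorphisms over the ground field and their Jacobians\<close>

locale rf_endomorphism = unital_ring_hom \<phi>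
  for \<phi> :: "'k::field ratfun2 \<Rightarrow> 'k ratfun2" +
  assumes const: "\<phi> (rf_const c) = rf_const c"
begin

lemma nonzero: "g \<noteq> 0 \<Longrightarrow> \<phi> g \<noteq> 0"
  using mult[of g "inverse g"] by (auto simp: one)

lemma divide: "\<phi> (f / g) = \<phi> f / \<phi> g"
proof (cases "g = 0")
  case False
  then have "\<phi> f = \<phi> (f / g) * \<phi> g"
    by (simp flip: mult)
  with nonzero[OF False] show ?thesis
    by (simp add: field_simps)
qed (simp add: zero)

lemmas power_int = unital_ring_hom_powi[OF unital_ring_hom_axioms]

lemma to_fract: "\<phi> (to_fract P) = rf_eval (\<phi> rf_X) (\<phi> rf_Y) P"
proof -
  interpret ev: unital_ring_hom "rf_eval (\<phi> rf_X) (\<phi> rf_Y)"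
    by (rule unital_ring_hom_rf_eval)
  have inner: "\<phi> (to_fract [:p:]) = rf_eval (\<phi> rf_X) (\<phi> rf_Y) [:p:]" for p
  proof (induction p)
    case 0
    show ?case by (simp add: zero ev.zero)
  next
    case (pCons a p)
    have "to_fract [:pCons a p:] = rf_const a + rf_X * to_fract [:p:]"
      by (simp add: rf_const_def rf_X_def flip: to_fract_add to_fract_mult)
    with pCons show ?case
      by (simp add: add mult const rf_eval_pCons_inner)
  qed
  show ?thesis
  proof (induction P)
    case 0
    show ?case by (simp add: zero ev.zero)
  next
    case (pCons p P)
    have "to_fract (pCons p P) = to_fract [:p:] + rf_Y * to_fract P"
      by (simp add: rf_Y_def flip: to_fract_add to_fract_mult)
    with pCons show ?case
      by (simp add: add mult inner rf_eval_pCons[of _ _ p P])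
  qed
qed

text \<open>Both sides satisfy the same product rule twisted by \<open>\<phi>\<close> and agree on
  polynomials, so clearing the denominator of \<open>g\<close> suffices.\<close>

lemma chain_rule:
  assumes "rf_derivation D"
  shows "D (\<phi> g) = \<phi> (rf_ddx g) * D (\<phi> rf_X) + \<phi> (rf_ddy g) * D (\<phi> rf_Y)"
proof -
  interpret D: rf_derivation D by fact
  define E where "E g = \<phi> (rf_ddx g) * D (\<phi> rf_X) + \<phi> (rf_ddy g) * D (\<phi> rf_Y)" for g
  have E_mult: "E (f * g) = \<phi> f * E g + \<phi> g * E f" for f g
    by (simp add: E_def rf_ddx_mult rf_ddy_mult add mult algebra_simps)
  have poly: "D (\<phi> (to_fract P)) = E (to_fract P)" for P
    by (simp add: E_def rf_to_fract to_fract D.chain_rule_rf_eval)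
  obtain a b where g: "g = Fract a b" and b: "b \<noteq> 0" by (cases g)
  have gb: "g * to_fract b = to_fract a" and nz: "to_fract b \<noteq> 0"
    using b by (simp_all add: g to_fract_def eq_fract Zero_fract_def)
  have "D (\<phi> (g * to_fract b)) = E (g * to_fract b)"
    by (simp add: gb poly)
  then have "D (\<phi> g) = E g"
    using nonzero[OF nz] by (simp add: mult D.mult E_mult poly)
  then show ?thesis by (simp add: E_def)
qed

text \<open>By the chain rule the Jacobian matrix is a product; take determinants.\<close>

lemma rf_jacobian: "rf_jacobian (\<phi> g) (\<phi> h) = \<phi> (rf_jacobian g h) * rf_jacobian (\<phi> rf_X) (\<phi> rf_Y)"
proof -
  note chain = chain_rule[OF rf_derivation_ddx] chain_rule[OF rf_derivation_ddy]
  show ?thesis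
    unfolding rf_jacobian_def diff mult chain[of g] chain[of h] by algebra
qed

text \<open>Compatibility with the bracket need only be checked on the generators, where it reads
  {\<phi> x, \<phi> y} = \<phi> {x,y}.\<close>

lemma poisson_endomorphismI:
  assumes "rf_jacobian (\<phi> rf_X) (\<phi> rf_Y) * f = \<phi> f"
  shows "poisson_endomorphism rf_const (rf_bracket f) \<phi>"
proof -
  have "\<phi> (rf_bracket f g h) = rf_bracket f (\<phi> g) (\<phi> h)" for g h
    unfolding rf_bracket_def rf_jacobian_def[symmetric] mult rf_jacobian[of g h] assms[symmetric]
    by (simp only: mult.assoc)
  then show ?thesis
    by (simp add: poisson_endomorphism_def one add mult const)
qed

end

text \<open>Evaluation at \<open>(u,v)\<close> has zero kernel by \<open>rf_eval_eq_0_imp\<close>,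
  so it extends to fractions.\<close>

lemma rf_endomorphism_exists:
  fixes u v :: "'k::field_char_0 ratfun2"
  assumes "rf_jacobian u v \<noteq> 0"
  obtains \<phi> where "rf_endomorphism \<phi>" "\<phi> rf_X = u" "\<phi> rf_Y = v"
proof
  note hom = unital_ring_hom_rf_eval[of u v] rf_eval_eq_0_imp[OF assms]
  note lift = fract_lift_to_fract[OF hom]
  show "rf_endomorphism (fract_lift (rf_eval u v))"
  proof (rule rf_endomorphism.intro)
    show "unital_ring_hom (fract_lift (rf_eval u v))"
      by (rule unital_ring_hom_fract_lift) (fact hom)+
    show "rf_endomorphism_axioms (fract_lift (rf_eval u v))"
      by standard (simp add: rf_const_def lift rf_eval_gens)
  qed
  show "fract_lift (rf_eval u v) rf_X = u" "fract_lift (rf_eval u v) rf_Y = v"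
    by (simp_all add: rf_X_def rf_Y_def lift rf_eval_gens)
qed

lemma rf_endomorphism_eqI:
  assumes "rf_endomorphism \<phi>" "rf_endomorphism \<psi>" "\<phi> rf_X = \<psi> rf_X" "\<phi> rf_Y = \<psi> rf_Y"
  shows "\<phi> g = \<psi> g"
proof -
  obtain a b where "g = Fract a b" by (cases g)
  then have "g = to_fract a / to_fract b"
    by (simp add: Fract_conv_to_fract)
  with assms show ?thesis
    by (simp add: rf_endomorphism.divide rf_endomorphism.to_fract)
qed

section \<open>A criterion for the failure of the Dixmier property\<close>

lemma rf_X_nonzero: "rf_X \<noteq> 0" and rf_Y_nonzero: "rf_Y \<noteq> 0"
  by (simp_all add: rf_X_def rf_Y_def)

text \<open>
  The endomorphism given by \<open>(u,v)\<close> takes values in the fixed field of the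
  endomorphism \<open>(s,t)\<close>, so it cannot be onto.
\<close>

lemma not_dixmier_propertyI:
  fixes u v s t f :: "'k::field_char_0 ratfun2"
  assumes f: "f \<noteq> 0"
    and poisson: "\<And>\<phi>. rf_endomorphism \<phi> \<Longrightarrow> \<phi> rf_X = u \<Longrightarrow> \<phi> rf_Y = v
      \<Longrightarrow> rf_jacobian u v * f = \<phi> f"
    and J_uv: "rf_jacobian u v \<noteq> 0" and J_st: "rf_jacobian s t \<noteq> 0"
    and fixed: "\<And>\<tau>. rf_endomorphism \<tau> \<Longrightarrow> \<tau> rf_X = s \<Longrightarrow> \<tau> rf_Y = t \<Longrightarrow> \<tau> u = u \<and> \<tau> v = v"
    and nontrivial: "s \<noteq> rf_X \<or> t \<noteq> rf_Y"
  shows "\<not> dixmier_property rf_const (rf_bracket f)"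
proof
  assume dix: "dixmier_property rf_const (rf_bracket f)"
  obtain \<phi> where \<phi>: "rf_endomorphism \<phi>" "\<phi> rf_X = u" "\<phi> rf_Y = v"
    using rf_endomorphism_exists[OF J_uv] by blast
  obtain \<tau> where \<tau>: "rf_endomorphism \<tau>" "\<tau> rf_X = s" "\<tau> rf_Y = t"
    using rf_endomorphism_exists[OF J_st] by blast
  interpret \<phi>: rf_endomorphism \<phi> by fact
  interpret \<tau>: rf_endomorphism \<tau> by fact
  have "poisson_endomorphism rf_const (rf_bracket f) \<phi>"
    by (rule \<phi>.poisson_endomorphismI) (simp add: \<phi> poisson)
  with dix have "surj \<phi>"
    by (auto simp: dixmier_property_def poisson_automorphism_def bij_def)
  moreover have "\<tau> (\<phi> g) = \<phi> g" for g
  proof -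
    have "rf_endomorphism (\<lambda>g. \<tau> (\<phi> g))"
      by standard (simp_all add: \<phi>.one \<phi>.add \<phi>.mult \<phi>.const \<tau>.one \<tau>.add \<tau>.mult \<tau>.const)
    then show ?thesis
      by (rule rf_endomorphism_eqI) (simp_all add: \<phi> fixed[OF \<tau>])
  qed
  \<comment> \<open>Every \<open>g\<close> lies in the image of \<open>\<phi>\<close>, which
    \<open>\<tau>\<close> fixes pointwise.\<close>
  ultimately have "\<tau> g = g" for g
    by (metis surjD)
  with \<tau> nontrivial show False by metis
qed


section \<open>Monomial and log-canonical endomorphisms\<close>

lemma of_int_ratfun2: "(of_int n :: 'k::field ratfun2) = rf_const (of_int n)"
proof -
  interpret c: unital_ring_hom "rf_const :: 'k \<Rightarrow> 'k ratfun2"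
    by (rule unital_ring_hom_rf_const)
  have "(of_nat m :: 'k ratfun2) = rf_const (of_nat m)" for m
    by (induction m) (simp_all add: c.zero c.one c.add)
  then show ?thesis
    by (cases n rule: int_cases2) (simp_all add: c.uminus)
qed

lemma rf_const_eq_iff: "rf_const a = rf_const b \<longleftrightarrow> a = b"
  by (simp add: rf_const_def)

lemma root_int_exists:
  fixes c :: "'k::alg_closed_field"
  assumes "n \<noteq> 0" "c \<noteq> 0"
  obtains a where "a \<noteq> 0" "a powi n = c"
proof -
  obtain a where a: "a ^ nat \<bar>n\<bar> = (if n > 0 then c else inverse c)"
    using nth_root_exists[of "nat \<bar>n\<bar>"] assms by auto
  with assms have "a \<noteq> 0"
    by (auto simp: power_0_left split: if_splits)
  moreover have "a powi n = c"
    using a assms by (auto simp: power_int_def power_inverse split: if_splits)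
  ultimately show thesis by (rule that)
qed

text \<open>Take a root of 1 + z + ... + z^(n-1); at z = 1 this sum is n, nonzero in characteristic
  zero.\<close>

lemma nontrivial_root_of_unity_exists:
  fixes n :: nat
  assumes "n \<ge> 2"
  obtains z :: "'k::{alg_closed_field, field_char_0}" where "z \<noteq> 1" "z ^ n = 1"
proof -
  obtain m where n: "n = Suc (Suc m)"
    using assms by (metis add_2_eq_Suc le_Suc_ex)
  obtain z :: 'k where z: "(\<Sum>k\<le>Suc m. 1 * z ^ k) = 0"
    using alg_closed[of "Suc m" "\<lambda>_. 1"] by auto
  have "z \<noteq> 1"
  proof
    assume "z = 1"
    with z have "(of_nat (Suc (Suc m)) :: 'k) = 0" by simp
    then show False by (simp only: of_nat_eq_0_iff)
  qed
  moreover have "z ^ n = 1"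
  proof -
    have "z ^ n - 1 = (z - 1) * (\<Sum>k<n. z ^ k)"
      by (rule power_diff_1_eq)
    also have "{..<n} = {..Suc m}"
      by (auto simp: n)
    finally show ?thesis using z by simp
  qed
  ultimately show thesis by (rule that)
qed

text \<open>Monomials are eigenvectors of x d/dx and y d/dy with their exponents as eigenvalues, so
  the determinant of the exponent matrix comes out.\<close>

lemma rf_jacobian_monomials:
  fixes \<alpha> \<beta> :: "'k::field" and a b c d :: int
  defines "u \<equiv> rf_const \<alpha> * rf_X powi a * rf_Y powi b"
    and "v \<equiv> rf_const \<beta> * rf_X powi c * rf_Y powi d"
  shows "rf_jacobian u v = of_int (a * d - b * c) * (u * v / (rf_X * rf_Y))"
proof -
  interpret dx: rf_derivation rf_ddx by (rule rf_derivation_ddx)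
  interpret dy: rf_derivation rf_ddy by (rule rf_derivation_ddy)
  have "rf_ddx (rf_const \<gamma> * rf_X powi m * rf_Y powi n)
      = of_int m * (rf_const \<gamma> * rf_X powi m * rf_Y powi n) / rf_X"
    "rf_ddy (rf_const \<gamma> * rf_X powi m * rf_Y powi n)
      = of_int n * (rf_const \<gamma> * rf_X powi m * rf_Y powi n) / rf_Y" for \<gamma> :: 'k and m n
    by (simp_all add: dx.mult dy.mult dx.const dy.const rf_X_nonzero rf_Y_nonzero
        dx.power_int dy.power_int rf_deriv_gens)
  then show ?thesis
    unfolding rf_jacobian_def u_def v_def
    by (simp only: of_int_diff of_int_mult) (simp add: field_simps rf_X_nonzero rf_Y_nonzero)
qed

section \<open>The case of nonzero \<kappa>\<close>

text \<open>
  The exponent matrix is \<open>I + w w\<^sup>T\<close> with \<open>w = (s,t)\<close> orthogonal to \<open>\<kappa>\<close>. It fixes \<open>\<kappa>\<close> and has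
  determinant \<open>d = 1 + s\<^sup>2 + t\<^sup>2\<close>, which the constants \<open>\<alpha>, \<beta>\<close> absorb.
\<close>

lemma not_dixmier_property_kappa_nonzero:
  fixes q :: "'k :: {alg_closed_field, field_char_0}"
    and \<kappa>1 \<kappa>2 :: int
  assumes q: "q \<noteq> 0" and \<kappa>: "\<kappa>1 \<noteq> 0 \<or> \<kappa>2 \<noteq> 0"
  shows "\<not> dixmier_property rf_const
           (rf_bracket (rf_const q * rf_X powi (1 + \<kappa>1) * rf_Y powi (1 + \<kappa>2)))"
proof -
  define s t where "s = - \<kappa>2" and "t = \<kappa>1"
  define d where "d = 1 + s\<^sup>2 + t\<^sup>2"
  have "s\<^sup>2 + t\<^sup>2 > 0"
    using \<kappa> by (auto simp: s_def t_def sum_power2_gt_zero_iff)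
  then have d: "d \<ge> 2" by (simp add: d_def)
  then have d_nz: "(of_int d :: 'k) \<noteq> 0" by simp
  obtain \<alpha> \<beta> :: 'k where \<alpha>\<beta>: "\<alpha> \<noteq> 0" "\<beta> \<noteq> 0" "\<alpha> powi \<kappa>1 * \<beta> powi \<kappa>2 = of_int d"
  proof (cases "\<kappa>1 = 0")
    case True
    then obtain b :: 'k where "b \<noteq> 0" "b powi \<kappa>2 = of_int d"
      using root_int_exists[OF _ d_nz] \<kappa> by metis
    then show ?thesis using that[of 1 b] by simp
  next
    case False
    then obtain a :: 'k where "a \<noteq> 0" "a powi \<kappa>1 = of_int d"
      using root_int_exists[OF _ d_nz] by metis
    then show ?thesis using that[of a 1] by simp
  qed
  have "nat d \<ge> 2" using d by simp
  then obtain z :: 'k where z1: "z \<noteq> 1" and zd: "z ^ nat d = 1"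
    by (rule nontrivial_root_of_unity_exists)
  then have z0: "z \<noteq> 0" and zd': "z powi d = 1"
    using d by (auto simp: power_int_def power_0_left split: if_splits)
  note c = unital_ring_hom_powi[OF unital_ring_hom_rf_const]
  define x y :: "'k ratfun2" where "x = rf_X" and "y = rf_Y"
  have xy: "x \<noteq> 0" "y \<noteq> 0" by (simp_all add: x_def y_def rf_X_nonzero rf_Y_nonzero)
  define u where "u = rf_const \<alpha> * x powi (1 + s\<^sup>2) * y powi (s * t)"
  define v where "v = rf_const \<beta> * x powi (s * t) * y powi (1 + t\<^sup>2)"
  have c_nz: "rf_const a \<noteq> 0" if "a \<noteq> 0" for a :: 'k
    using that by (simp add: rf_const_def)
  have uv_nz: "u \<noteq> 0" "v \<noteq> 0"
    using \<alpha>\<beta> xy by (simp_all add: u_def v_def c_nz)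
  have J: "rf_jacobian u v = of_int d * (u * v / (x * y))"
    unfolding u_def v_def x_def y_def rf_jacobian_monomials
    by (simp add: d_def power2_eq_square algebra_simps)
  have "u powi \<kappa>1 * v powi \<kappa>2 = rf_const (\<alpha> powi \<kappa>1 * \<beta> powi \<kappa>2)
      * x powi ((1 + s\<^sup>2) * \<kappa>1 + s * t * \<kappa>2) * y powi (s * t * \<kappa>1 + (1 + t\<^sup>2) * \<kappa>2)"
    using xy by (simp add: u_def v_def power_int_mult_distrib power_int_mult power_int_add
        rf_const_hom c)
  also have "(1 + s\<^sup>2) * \<kappa>1 + s * t * \<kappa>2 = \<kappa>1"
    by (simp add: s_def t_def power2_eq_square algebra_simps)
  also have "s * t * \<kappa>1 + (1 + t\<^sup>2) * \<kappa>2 = \<kappa>2"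
    by (simp add: s_def t_def power2_eq_square algebra_simps)
  finally have inv: "u powi \<kappa>1 * v powi \<kappa>2 = of_int d * x powi \<kappa>1 * y powi \<kappa>2"
    by (simp add: \<alpha>\<beta> of_int_ratfun2)
  \<comment> \<open>The diagonal map by z^s and z^t will fix \<open>u\<close> and
    \<open>v\<close>.\<close>
  define X Y where "X = rf_const (z powi s) * x" and "Y = rf_const (z powi t) * y"
  have JXY: "rf_jacobian X Y = rf_const (z powi s) * rf_const (z powi t)"
    using rf_jacobian_monomials[of "z powi s" 1 0 "z powi t" 0 1] xy
    by (simp add: X_def Y_def x_def y_def)
  show ?thesis
  proof (rule not_dixmier_propertyI[where u = u and v = v and s = X and t = Y])
    show "rf_const q * rf_X powi (1 + \<kappa>1) * rf_Y powi (1 + \<kappa>2) \<noteq> 0"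
      using q by (simp add: c_nz rf_X_nonzero rf_Y_nonzero)
    show "rf_jacobian u v \<noteq> 0"
      using uv_nz xy d_nz by (simp add: J of_int_ratfun2 c_nz)
    show "rf_jacobian X Y \<noteq> 0"
      using z0 by (simp add: JXY c_nz)
    show "X \<noteq> rf_X \<or> Y \<noteq> rf_Y"
    proof (rule ccontr)
      assume "\<not> (X \<noteq> rf_X \<or> Y \<noteq> rf_Y)"
      then have "rf_const (z powi s) = rf_const 1" "rf_const (z powi t) = rf_const 1"
        using xy by (simp_all add: X_def Y_def x_def y_def rf_const_hom)
      then have zst: "z powi s = 1" "z powi t = 1"
        by (simp_all only: rf_const_eq_iff)
      \<comment> \<open>Since d = 1 + s^2 + t^2, trivial z^s and z^t would give z = z^d = 1.\<close>
      have "z powi d = z * (z powi s) powi s * (z powi t) powi t"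
        using z0 by (simp add: d_def power2_eq_square power_int_add flip: power_int_mult)
      with zst zd' z1 show False by simp
    qed
    fix \<phi> assume "rf_endomorphism \<phi>" and \<phi>: "\<phi> rf_X = u" "\<phi> rf_Y = v"
    then interpret \<phi>: rf_endomorphism \<phi> by simp
    have "rf_jacobian u v * (rf_const q * rf_X powi (1 + \<kappa>1) * rf_Y powi (1 + \<kappa>2))
        = rf_const q * u * v * (of_int d * x powi \<kappa>1 * y powi \<kappa>2)"
      using xy by (simp add: J x_def y_def power_int_add)
    also have "\<dots> = \<phi> (rf_const q * rf_X powi (1 + \<kappa>1) * rf_Y powi (1 + \<kappa>2))"
      using uv_nz by (simp add: \<phi>.mult \<phi>.const \<phi>.power_int \<phi> power_int_add flip: inv)
    finally show "rf_jacobian u v * (rf_const q * rf_X powi (1 + \<kappa>1) * rf_Y powi (1 + \<kappa>2))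
        = \<phi> (rf_const q * rf_X powi (1 + \<kappa>1) * rf_Y powi (1 + \<kappa>2))" .
  next
    fix \<tau> assume "rf_endomorphism \<tau>" and \<tau>: "\<tau> rf_X = X" "\<tau> rf_Y = Y"
    then interpret \<tau>: rf_endomorphism \<tau> by simp
    have mono: "\<tau> (rf_const a * x powi m * y powi n)
        = rf_const (z powi (s * m + t * n)) * (rf_const a * x powi m * y powi n)" for a m n
      using z0 by (simp add: \<tau>.mult \<tau>.const \<tau>.power_int \<tau> x_def y_def X_def Y_def
          power_int_mult_distrib power_int_add power_int_mult rf_const_hom c)
    \<comment> \<open>The vector w is an eigenvector of \<open>I + w w^T\<close> with eigenvalue d,
      so \<open>u\<close> and \<open>v\<close> are multiplied by powers of z^d = 1.\<close>
    have "s * (1 + s\<^sup>2) + t * (s * t) = d * s" "s * (s * t) + t * (1 + t\<^sup>2) = d * t"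
      by (simp_all add: d_def power2_eq_square algebra_simps)
    then show "\<tau> u = u \<and> \<tau> v = v"
      unfolding u_def v_def mono by (simp add: power_int_mult zd' rf_const_hom)
  qed
qed

section \<open>The case \<kappa> = 0\<close>

text \<open>
  Here the fixed field of \<open>(x,y) \<mapsto> (1/x,1/y)\<close> is again rational, with log-canonical generators
  \<open>(y - 1/y) / (x y - 1/(x y))\<close> and \<open>(x - 1/x) / (x y - 1/(x y))\<close>; the bracket of these is the
  addition formula for the hyperbolic cotangent. Below both fractions are cleared of negative powers.
\<close>

lemma not_dixmier_property_kappa_zero:
  fixes q :: "'k :: field_char_0"
  assumes q: "q \<noteq> 0"
  shows "\<not> dixmier_property rf_const (rf_bracket (rf_const q * rf_X * rf_Y))"
proof -
  interpret dx: rf_derivation "rf_ddx :: 'k ratfun2 \<Rightarrow> _" by (rule rf_derivation_ddx)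
  interpret dy: rf_derivation "rf_ddy :: 'k ratfun2 \<Rightarrow> _" by (rule rf_derivation_ddy)
  define x y :: "'k ratfun2" where "x = rf_X" and "y = rf_Y"
  have xy: "x \<noteq> 0" "y \<noteq> 0" by (simp_all add: x_def y_def rf_X_nonzero rf_Y_nonzero)
  have der: "rf_ddx x = 1" "rf_ddx y = 0" "rf_ddy x = 0" "rf_ddy y = 1"
    by (simp_all add: x_def y_def rf_deriv_gens)
  have c_nz: "rf_const a \<noteq> 0" if "a \<noteq> 0" for a :: 'k
    using that by (simp add: rf_const_def)
  have two: "(2 :: 'k ratfun2) \<noteq> 0"
    using of_int_ratfun2[where 'k = 'k and n = 2] c_nz[of 2] by simp
  note rules = dx.add dx.diff dx.mult dx.one dy.add dy.diff dy.mult dy.one der power2_eq_square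
  define M N L where "M = x\<^sup>2 - 1" and "N = y\<^sup>2 - 1" and "L = x\<^sup>2 * y\<^sup>2 - 1"
  have M': "rf_ddx M = 2 * x" "rf_ddy M = 0" and N': "rf_ddx N = 0" "rf_ddy N = 2 * y"
    and L': "rf_ddx L = 2 * x * y\<^sup>2" "rf_ddy L = 2 * x\<^sup>2 * y"
    by (simp_all add: M_def N_def L_def rules)
  have nz: "M \<noteq> 0" "N \<noteq> 0" "L \<noteq> 0"
    \<comment> \<open>Each of the three has a nonzero partial derivative, as 2 is nonzero.\<close>
    using M' N' L' two xy dx.zero dy.zero by auto
  define u v where "u = x * N / L" and "v = y * M / L"
  have der_uv: "rf_ddx u = - (N * (x\<^sup>2 * y\<^sup>2 + 1)) / L\<^sup>2" "rf_ddy u = 2 * x * y * M / L\<^sup>2"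
    "rf_ddx v = 2 * x * y * N / L\<^sup>2" "rf_ddy v = - (M * (x\<^sup>2 * y\<^sup>2 + 1)) / L\<^sup>2"
    unfolding u_def v_def dx.divide[OF nz(3)] dy.divide[OF nz(3)] dx.mult dy.mult M' N' L' der
    by (rule arg_cong[where f = "\<lambda>a. a / L\<^sup>2"], simp add: M_def N_def L_def power2_eq_square algebra_simps)+
  have "rf_jacobian u v = M * N * ((x\<^sup>2 * y\<^sup>2 + 1)\<^sup>2 - (2 * x * y)\<^sup>2) / (L\<^sup>2 * L\<^sup>2)"
    unfolding rf_jacobian_def der_uv using nz by (simp add: divide_simps) (simp add: power2_eq_square algebra_simps)
  also have "(x\<^sup>2 * y\<^sup>2 + 1)\<^sup>2 - (2 * x * y)\<^sup>2 = L\<^sup>2"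
    by (simp add: L_def power2_eq_square algebra_simps)
  finally have J: "rf_jacobian u v = M * N / L\<^sup>2"
    using nz by (simp add: power2_eq_square)
  have J_inv: "rf_jacobian (1 / x) (1 / y) = 1 / (x\<^sup>2 * y\<^sup>2)"
    using xy by (simp add: rf_jacobian_def dx.divide dy.divide dx.one dy.one der)
  show ?thesis
  proof (rule not_dixmier_propertyI[where u = u and v = v and s = "1 / x" and t = "1 / y"])
    show "rf_const q * rf_X * rf_Y \<noteq> 0"
      using q by (simp add: c_nz rf_X_nonzero rf_Y_nonzero)
    show "rf_jacobian u v \<noteq> 0"
      using nz by (simp add: J)
    show "rf_jacobian (1 / x) (1 / y) \<noteq> 0"
      using xy by (simp add: J_inv)
    show "1 / x \<noteq> rf_X \<or> 1 / y \<noteq> rf_Y"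
      using nz(1) xy by (auto simp: x_def[symmetric] M_def field_simps power2_eq_square)
    fix \<phi> assume "rf_endomorphism \<phi>" and \<phi>: "\<phi> rf_X = u" "\<phi> rf_Y = v"
    then interpret \<phi>: rf_endomorphism \<phi> by simp
    show "rf_jacobian u v * (rf_const q * rf_X * rf_Y) = \<phi> (rf_const q * rf_X * rf_Y)"
      unfolding \<phi>.mult \<phi>.const \<phi> J
      by (simp add: u_def v_def x_def y_def power2_eq_square)
  next
    fix \<tau> assume "rf_endomorphism \<tau>" and \<tau>: "\<tau> rf_X = 1 / x" "\<tau> rf_Y = 1 / y"
    then interpret \<tau>: rf_endomorphism \<tau> by simp
    have \<tau>xy: "\<tau> x = 1 / x" "\<tau> y = 1 / y"
      using \<tau> by (simp_all add: x_def y_def)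
    \<comment> \<open>All three change sign, so the signs cancel in the quotients \<open>u\<close>
      and \<open>v\<close>, as do the monomial factors.\<close>
    have "\<tau> M = - M / x\<^sup>2" "\<tau> N = - N / y\<^sup>2" "\<tau> L = - L / (x\<^sup>2 * y\<^sup>2)"
      using xy by (simp_all add: M_def N_def L_def \<tau>.diff \<tau>.mult \<tau>.power \<tau>.one \<tau>xy field_simps)
    then show "\<tau> u = u \<and> \<tau> v = v"
      using xy nz by (simp add: u_def v_def \<tau>.divide \<tau>.mult \<tau>xy power2_eq_square)
  qed
qed

theorem proposition4p12:
  fixes q :: "'k :: {alg_closed_field, field_char_0}"
    and \<kappa>1 \<kappa>2 :: int
  assumes "q \<noteq> 0"
  shows "\<not> dixmier_property rf_const
           (rf_bracket (rf_const q * rf_X powi (1 + \<kappa>1) * rf_Y powi (1 + \<kappa>2)))"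
proof (cases "\<kappa>1 = 0 \<and> \<kappa>2 = 0")
  case True
  then show ?thesis
    using not_dixmier_property_kappa_zero[OF assms] by simp
next
  case False
  then show ?thesis
    using not_dixmier_property_kappa_nonzero[OF assms] by blast
qed

end
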